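(* Let $n\ge 1$, let $\mathbb{X}\subseteq\mathbb{R}^n$, $b\in\mathbb{R}$, $\epsilon\in[0,1)$, let $g:\mathbb{R}\to\mathbb{R}$ be convex and non-decreasing, and let $\pi:\mathbb{R}^n\to[0,1]$ be a joint possibility distribution satisfying the standing assumptions listed in the context, with confidence sets $\mathcal{C}(\lambda)$, $\lambda\in[0,1]$, and $\mathcal{U}=\mathcal{C}(0)$. Let $\ell$ be a positive integer, $\Lambda=\{0,1,\dots,\ell\}$, $\lambda_i=i/\ell$ for $i\in\Lambda$, and $$\mathcal{P}^{\ell}_\pi=\{\mathrm{P}\in\mathcal{P}(\mathcal{U}):\ \mathrm{P}(\mathcal{C}(\lambda_i))\ge 1-\lambda_i\ \ \forall i\in\Lambda\}.$$ Then for every $\boldsymbol{x}\in\mathbb{X}$, the constraint $$\sup_{\mathrm{P}\in\mathcal{P}^{\ell}_\pi}\mathrm{CVaR}^{\epsilon}_{\mathrm{P}}[g(\tilde{\boldsymbol{a}}^T\boldsymbol{x})]\le b$$ (where $\tilde{\boldsymbol a}$ is the random vector with distribution $\mathrm{P}$) is equivalent to the following semi-infinite system of constraints, i.e. it holds if and only if there exist $w,t\in\mathbb{R}$ and $v_i\in\mathbb{R}$, $i\in\Lambda$, such that $$\begin{aligned} & w+\sum_{i\in\Lambda}(\lambda_i-1)v_i\le (b-t)(1-\epsilon),\\ & w-\sum_{j\le i}v_j\ge 0 && \forall i\in\Lambda,\\ & w-\sum_{j\le i}v_j+t\ge g(\boldsymbol{a}^T\boldsymbol{x}) && \forall \boldsymbol{a}\in\mathcal{C}(\lambda_i),\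 \forall i\in\Lambda,\\ & v_i\ge 0 && \forall i\in\Lambda, \end{aligned}$$ where $\sum_{j\le i}$ denotes summation over $j\in\{0,\dots,i\}$.
   Context: For a function (possibility distribution) $\pi:\mathbb{R}^n\to[0,1]$ define $\mathcal{C}(\lambda)=\{\boldsymbol{a}\in\mathbb{R}^n:\pi(\boldsymbol{a})\ge\lambda\}$ for $\lambda\in(0,1]$. The induced necessity measure is $\mathrm{N}(A)=1-\sup_{\boldsymbol{a}\notin A}\pi(\boldsymbol{a})$ (with $\mathrm N(\mathbb R^n)=1$). $\mathcal{C}(0)$ denotes the support of $\pi$, i.e. the smallest (with respect to inclusion) closed subset of $\mathbb{R}^n$ such that $\mathrm{N}(\mathcal{C}(0))=1$. Standing assumptions on $\pi$: (1) there is $\hat{\boldsymbol{a}}\in\mathbb{R}^n$ with $\pi(\hat{\boldsymbol{a}})=1$; (2) $\pi$ is continuous in $\mathcal{C}(0)$; (3) the support $\mathcal{C}(0)$ coincides with the scenario set $\mathcal{U}$ and is compact; (4) the sets $\mathcal{C}(\lambda)$, $\lambda\in[0,1]$, are closed and convex; (5) the sets $\mathcal{C}(\lambda)$, $\lambda\in[0,1)$, have non-empty interiors. $\mathcal{P}(\mathcal{U})$ is the set of all (Borel) probability distributions in $\mathcal{U}$. For $\epsilon\in[0,1)$ and a real random variable $\mathrm{X}$, the Conditional Value at Risk with respect to $\mathrm{P}$ is $$\mathrm{CVaR}^{\epsilon}_{\mathrm{P}}[\mathrm{X}]=\inf_{t\in\mathbb{R}}\Big(t+\frac{1}{1-\epsilon}\,\mathbb{E}_{\mathrm{P}}\big[[\mathrm{X}-t]_+\big]\Big),\qquad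 [y]_+=\max\{0,y\}.$$ *)

theory Defs
  imports "HOL-Probability.Probability"
begin

definition necessity :: "('a \<Rightarrow> real) \<Rightarrow> 'a set \<Rightarrow> real" where
  "necessity \<pi> A = (if A = UNIV then 1 else 1 - (SUP a\<in>- A. \<pi> a))"

definition poss_support :: "('a::topological_space \<Rightarrow> real) \<Rightarrow> 'a set" where
  "poss_support \<pi> = (LEAST S. closed S \<and> necessity \<pi> S = 1)"

definition conf_set :: "('a::topological_space \<Rightarrow> real) \<Rightarrow> real \<Rightarrow> 'a set" where
  "conf_set \<pi> \<alpha> = (if \<alpha> = 0 then poss_support \<pi> else {a. \<alpha> \<le> \<pi> a})"

text \<open>The least set in the definition of the support always exists:\<close>

lemma necessity_eq_1_iff:
  assumes "\<And>a. 0 \<le> \<pi> a" "\<And>a. \<pi> a \<le> 1"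
  shows "necessity \<pi> A = 1 \<longleftrightarrow> {a. 0 < \<pi> a} \<subseteq> A"
proof (cases "A = UNIV")
  case False
  have bdd: "bdd_above (\<pi> ` (- A))"
    using assms(2) by (auto intro!: bdd_aboveI[where M = 1])
  have ne: "- A \<noteq> {}" using False by auto
  have "(SUP a\<in>- A. \<pi> a) = 0 \<longleftrightarrow> (\<forall>a\<in>- A. \<pi> a = 0)"
  proof
    assume S: "(SUP a\<in>- A. \<pi> a) = 0"
    show "\<forall>a\<in>- A. \<pi> a = 0"
      using cSUP_upper[OF _ bdd] S assms(1) by (metis order_antisym)
  next
    assume "\<forall>a\<in>- A. \<pi> a = 0"
    then have "\<pi> ` (- A) = {0}" using ne by force
    then show "(SUP a\<in>- A. \<pi> a) = 0" by simp
  qed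
  also have "\<dots> \<longleftrightarrow> {a. 0 < \<pi> a} \<subseteq> A"
    using assms(1) by (auto simp: less_le)
  finally show ?thesis using False by (simp add: necessity_def)
qed (simp add: necessity_def)

lemma poss_support_eq:
  assumes "\<And>a. 0 \<le> \<pi> a" "\<And>a. \<pi> a \<le> 1"
  shows "poss_support \<pi> = closure {a. 0 < \<pi> a}"
  unfolding poss_support_def necessity_eq_1_iff[OF assms]
  by (rule Least_equality) (auto simp: closure_subset closure_minimal)

text \<open>Borel probability measures on \<open>U\<close>; note that \<open>space P = U\<close> follows.\<close>

definition prob_distributions :: "'a::topological_space set \<Rightarrow> 'a measure set" where
  "prob_distributions U =
     {P. prob_space P \<and> sets P = sets (restrict_space borel U)}"

definition ambiguity_set ::
    "('a::topological_space \<Rightarrow> real) \<Rightarrow> nat \<Rightarrow> 'a set \<Rightarrow> 'a measure set" where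
  "ambiguity_set \<pi> l U =
     {P \<in> prob_distributions U.
        \<forall>i\<in>{0..l}. measure P (conf_set \<pi> (real i / real l)) \<ge> 1 - real i / real l}"

text \<open>
  The expectation of the nonnegative variable \<open>[X - t]\<^sub>+\<close> is the nonnegative Lebesgue
  integral, so that neither the expectation nor the infimum and supremum of such
  expressions depend on conventions for divergent integrals or unbounded sets.
\<close>

definition CVaR :: "real \<Rightarrow> 'a measure \<Rightarrow> ('a \<Rightarrow> real) \<Rightarrow> ereal" where
  "CVaR \<epsilon> P X =
     (INF t::real. ereal t + ereal (1 / (1 - \<epsilon>)) *
        enn2ereal (\<integral>\<^sup>+ \<omega>. ennreal (max 0 (X \<omega> - t)) \<partial>P))"

lemma CVaR_eq_expectation:
  assumes "prob_space P" "integrable P X"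
  shows "CVaR \<epsilon> P X =
    (INF t::real. ereal (t + 1 / (1 - \<epsilon>) * (\<integral>\<omega>. max 0 (X \<omega> - t) \<partial>P)))"
proof -
  interpret prob_space P by fact
  have "enn2ereal (\<integral>\<^sup>+ \<omega>. ennreal (max 0 (X \<omega> - t)) \<partial>P) =
      ereal (\<integral>\<omega>. max 0 (X \<omega> - t) \<partial>P)" for t
  proof -
    have "integrable P (\<lambda>\<omega>. max 0 (X \<omega> - t))"
      using assms(2) by (intro integrable_max) auto
    then have "(\<integral>\<^sup>+ \<omega>. ennreal (max 0 (X \<omega> - t)) \<partial>P) =
        ennreal (\<integral>\<omega>. max 0 (X \<omega> - t) \<partial>P)"
      by (intro nn_integral_eq_integral) auto
    then show ?thesis by (simp add: enn2ereal_ennreal)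
  qed
  then show ?thesis by (simp add: CVaR_def)
qed

end

theory Submission
  imports Defs
begin

text \<open>
  Let \<open>a\<^sub>k\<close> maximise \<open>a \<bullet> x\<close> over the level set \<open>C(k/l)\<close>. The uniform distribution on
  \<open>a\<^sub>0, \<dots>, a\<^sub>l\<^sub>-\<^sub>1\<close> belongs to the ambiguity set, and its CVaR is an infimum over \<open>t\<close> that is
  attained. At a minimiser \<open>t\<close> the numbers \<open>y\<^sub>k = [g(a\<^sub>k \<bullet> x) - t]\<^sub>+\<close> decrease in \<open>k\<close>, and
  \<open>w = y\<^sub>0\<close>, \<open>v\<^sub>k = y\<^sub>k\<^sub>-\<^sub>1 - y\<^sub>k\<close> solves the system, since by summation by parts
  the first constraint says that \<open>t\<close> plus \<open>1/(1-\<epsilon>)\<close> times the mean of \<open>y\<^sub>0, \<dots>, y\<^sub>l\<^sub>-\<^sub>1\<close> is at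
  most \<open>b\<close>. Conversely, a solution of the system gives the pointwise bound
  \<open>[g(a \<bullet> x) - t]\<^sub>+ \<le> w - (\<Sum>j. v\<^sub>j 1[a \<in> C(j/l)])\<close>, which is integrated against an
  arbitrary member of the ambiguity set.
\<close>

text \<open>Only \<open>\<alpha> = 0 < \<beta>\<close> needs an argument: at level 0
  \<open>conf_set\<close> switches to the support, the closure of the positivity set of
  \<open>\<pi>\<close>, which contains every superlevel set of positive level.\<close>

lemma conf_set_antimono:
  assumes "\<And>a. 0 \<le> \<pi> a" "\<And>a. \<pi> a \<le> 1" "0 \<le> \<alpha>" "\<alpha> \<le> \<beta>"
  shows "conf_set \<pi> \<beta> \<subseteq> conf_set \<pi> \<alpha>"
proof (cases "\<alpha> = 0 \<and> 0 < \<beta>")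
  case True
  then have "conf_set \<pi> \<beta> \<subseteq> {a. 0 < \<pi> a}"
    by (auto simp: conf_set_def)
  also have "\<dots> \<subseteq> conf_set \<pi> \<alpha>"
    using True by (simp add: conf_set_def poss_support_eq[OF assms(1,2)] closure_subset)
  finally show ?thesis .
next
  case False
  then show ?thesis
    using assms(3,4) by (auto simp: conf_set_def)
qed

text \<open>Swapping the sums, \<open>v i\<close> occurs in the partial sums with index
  \<open>k = i, ..., l - 1\<close>, hence \<open>l - i\<close> times. This turns the left side of
  the first constraint into a mean of slacks.\<close>

lemma sum_by_parts_weights:
  fixes v :: "nat \<Rightarrow> real"
  assumes "0 < l"
  shows "w + (\<Sum>i\<in>{0..l}. (real i / real l - 1) * v i) =
    (\<Sum>k<l. w - (\<Sum>j\<in>{0..k}. v j)) / real l"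
proof -
  \<comment> \<open>The coefficient \<open>m\<close> is decoupled from \<open>l\<close> so that it
    stays fixed in the induction; the correction term vanishes at \<open>m = l\<close>.\<close>
  have "(\<Sum>i\<in>{0..l}. (real m - real i) * v i) =
      (\<Sum>k<l. \<Sum>j\<in>{0..k}. v j) + (real m - real l) * (\<Sum>j\<in>{0..l}. v j)" for m
    by (induction l) (auto simp: algebra_simps sum.distrib)
  from this[of l]
  have *: "(\<Sum>i\<in>{0..l}. (real l - real i) * v i) = (\<Sum>k<l. \<Sum>j\<in>{0..k}. v j)"
    by simp
  have "(\<Sum>i\<in>{0..l}. (real i / real l - 1) * v i) =
      - (\<Sum>i\<in>{0..l}. (real l - real i) * v i) / real l"
    unfolding sum_negf[symmetric] sum_divide_distrib
    using assms by (intro sum.cong) (auto simp: field_simps)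
  then show ?thesis
    using assms unfolding * by (simp add: sum_subtractf field_simps)
qed

text \<open>The objective has slope \<open>1 - c * l \<le> 0\<close> to the left of all
  \<open>M k\<close> and slope 1 to their right, so a minimum over the compact interval spanned by
  the \<open>M k\<close> is global.\<close>

lemma sum_excess_attains_min:
  fixes M :: "nat \<Rightarrow> real"
  assumes "0 < l" "1 \<le> c * real l"
  obtains s where "\<And>t. s + c * (\<Sum>k<l. max 0 (M k - s)) \<le> t + c * (\<Sum>k<l. max 0 (M k - t))"
proof -
  define f where "f = (\<lambda>t. t + c * (\<Sum>k<l. max 0 (M k - t)))"
  define lo where "lo = Min (M ` {..<l})"
  define hi where "hi = Max (M ` {..<l})"
  have lo: "lo \<le> M k" and hi: "M k \<le> hi" if "k < l" for k
    using that by (auto simp: lo_def hi_def)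
  have "lo \<le> hi"
    using lo[OF assms(1)] hi[OF assms(1)] by linarith
  have "continuous_on {lo..hi} f"
    unfolding f_def by (intro continuous_intros)
  then obtain s where s: "\<And>t. t \<in> {lo..hi} \<Longrightarrow> f s \<le> f t"
    using continuous_attains_inf[of "{lo..hi}" f] \<open>lo \<le> hi\<close>
    by (metis atLeastAtMost_iff compact_Icc empty_iff order_refl)
  have below: "f lo \<le> f t" if "t \<le> lo" for t
  proof -
    have sum: "(\<Sum>k<l. max 0 (M k - r)) = (\<Sum>k<l. M k) - real l * r" if "r \<le> lo" for r
    proof -
      have "(\<Sum>k<l. max 0 (M k - r)) = (\<Sum>k<l. M k - r)"
        using that lo by (intro sum.cong) (auto simp: max_def dest: order_trans)
      then show ?thesis by (simp add: sum_subtractf)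
    qed
    have "f t - f lo = (c * real l - 1) * (lo - t)"
      using that by (simp add: f_def sum algebra_simps)
    moreover have "\<dots> \<ge> 0"
      using assms(2) that by simp
    ultimately show ?thesis by linarith
  qed
  have above: "f hi \<le> f t" if "hi \<le> t" for t
  proof -
    have "(\<Sum>k<l. max 0 (M k - r)) = 0" if "hi \<le> r" for r
      using that hi by (intro sum.neutral) (force simp: max_def)
    then show ?thesis using that by (simp add: f_def)
  qed
  have "f s \<le> f t" for t
    using s[of t] s[of lo] s[of hi] below[of t] above[of t] \<open>lo \<le> hi\<close>
    by (cases "t \<le> lo"; cases "hi \<le> t") auto
  then show ?thesis
    using that by (auto simp: f_def)
qed

text \<open>The law is the image of a finitely supported one, so \<open>X\<close> is integrable and
  the expectations are means over the indices. Values of \<open>a\<close> may repeat.\<close>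

lemma CVaR_uniform:
  assumes l: "0 < l"
    and a: "a \<in> measurable (count_space UNIV) N"
    and X: "X \<in> borel_measurable N"
  shows "CVaR \<epsilon> (distr (measure_pmf (pmf_of_set {..<l::nat})) N a) X =
    (INF t. ereal (t + 1 / (1 - \<epsilon>) * ((\<Sum>k<l. max 0 (X (a k) - t)) / real l)))"
proof -
  let ?M = "measure_pmf (pmf_of_set {..<l})"
  have set: "{..<l} \<noteq> {}" "finite {..<l}"
    using l by auto
  have a': "a \<in> measurable ?M N"
    using a by simp
  have "prob_space (distr ?M N a)"
    by (intro prob_space.prob_space_distr a' prob_space_measure_pmf)
  moreover have "integrable (distr ?M N a) X"
    unfolding integrable_distr_eq[OF a' X]
    using set by (intro integrable_measure_pmf_finite) simp
  moreover have "(\<integral>\<omega>. max 0 (X \<omega> - t) \<partial>distr ?M N a) =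
      (\<Sum>k<l. max 0 (X (a k) - t)) / real l" for t
    using X by (simp add: integral_distr[OF a'] integral_pmf_of_set[OF set])
  ultimately show ?thesis
    by (simp add: CVaR_eq_expectation)
qed

text \<open>Weak duality: since \<open>v j \<ge> 0\<close> and \<open>D j\<close> has mass at least
  \<open>p j\<close>, the dominating function has expectation at most
  \<open>w - (\<Sum>j\<in>J. v j * p j)\<close>. The given \<open>t\<close> then bounds the
  infimum.\<close>

lemma CVaR_le_of_dominated:
  assumes P: "prob_space P"
    and eps: "\<epsilon> < 1"
    and D: "\<And>j. j \<in> J \<Longrightarrow> D j \<in> sets P" "\<And>j. j \<in> J \<Longrightarrow> p j \<le> measure P (D j)"
    and v: "\<And>j. j \<in> J \<Longrightarrow> 0 \<le> v j"
    and dom: "\<And>\<omega>. \<omega> \<in> space P \<Longrightarrow> max 0 (X \<omega> - t) \<le> w - (\<Sum>j\<in>J. v j * indicator (D j) \<omega>)"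
    and bound: "w - (\<Sum>j\<in>J. v j * p j) \<le> (b - t) * (1 - \<epsilon>)"
  shows "CVaR \<epsilon> P X \<le> ereal b"
proof -
  interpret prob_space P by fact
  let ?h = "\<lambda>\<omega>. w - (\<Sum>j\<in>J. v j * indicator (D j) \<omega>)"
  let ?I = "\<integral>\<^sup>+ \<omega>. ennreal (max 0 (X \<omega> - t)) \<partial>P"
  have int: "integrable P (\<lambda>\<omega>. v j * indicator (D j) \<omega>)" if "j \<in> J" for j
    using D(1)[OF that] by (intro integrable_mult_right) (simp add: emeasure_eq_measure)
  have nonneg: "0 \<le> ?h \<omega>" if "\<omega> \<in> space P" for \<omega>
    using dom[OF that] by (meson max.cobounded1 order_trans)
  have "(\<integral>\<omega>. ?h \<omega> \<partial>P) = w - (\<Sum>j\<in>J. v j * measure P (D j))"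
    using int D(1) by (simp add: Bochner_Integration.integral_diff
        Bochner_Integration.integral_sum prob_space)
  also have "\<dots> \<le> w - (\<Sum>j\<in>J. v j * p j)"
    using D(2) v by (intro diff_left_mono sum_mono mult_left_mono)
  also note bound
  finally have h: "(\<integral>\<omega>. ?h \<omega> \<partial>P) \<le> (b - t) * (1 - \<epsilon>)" .
  have "?I \<le> (\<integral>\<^sup>+ \<omega>. ennreal (?h \<omega>) \<partial>P)"
    using dom by (intro nn_integral_mono ennreal_leI)
  also have "\<dots> = ennreal (\<integral>\<omega>. ?h \<omega> \<partial>P)"
    using int nonneg by (intro nn_integral_eq_integral) auto
  finally have I: "?I \<le> ennreal ((b - t) * (1 - \<epsilon>))"
    using h ennreal_leI order_trans by blast
  \<comment> \<open>\<open>ennreal\<close> truncates negative reals to 0, so the bound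
    \<open>I\<close> can be read in \<open>ereal\<close> only once its right side is known to be
    nonnegative.\<close>
  have "0 \<le> (\<integral>\<omega>. ?h \<omega> \<partial>P)"
    using nonneg by (intro integral_nonneg_AE) auto
  then have "0 \<le> (b - t) * (1 - \<epsilon>)"
    using h by linarith
  then have "enn2ereal ?I \<le> ereal ((b - t) * (1 - \<epsilon>))"
    using I by (metis enn2ereal_ennreal less_eq_ennreal.rep_eq)
  then have "ereal (1 / (1 - \<epsilon>)) * enn2ereal ?I \<le>
      ereal (1 / (1 - \<epsilon>)) * ereal ((b - t) * (1 - \<epsilon>))"
    using eps by (intro ereal_mult_left_mono) auto
  also have "\<dots> = ereal (b - t)"
    using eps by simp
  finally have "ereal t + ereal (1 / (1 - \<epsilon>)) * enn2ereal ?I \<le> ereal t + ereal (b - t)"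
    by (rule add_left_mono)
  then show ?thesis
    unfolding CVaR_def by (intro INF_lower2[of t]) auto
qed

theorem theorem1:
  fixes \<pi> :: "real ^ 'n \<Rightarrow> real"
    and \<X> \<U> :: "(real ^ 'n) set"
    and b \<epsilon> :: real
    and g :: "real \<Rightarrow> real"
    and l :: nat
  assumes eps: "0 \<le> \<epsilon>" "\<epsilon> < 1"
    and g_convex: "convex_on UNIV g"
    and g_mono: "mono g"
    and pi_range: "\<And>a. 0 \<le> \<pi> a \<and> \<pi> a \<le> 1"
    and pi_normal: "\<exists>a_hat. \<pi> a_hat = 1"
    and pi_cont: "continuous_on (conf_set \<pi> 0) \<pi>"
    and supp: "conf_set \<pi> 0 = \<U>" "compact \<U>"
    and conf_closed_convex:
      "\<And>\<alpha>. \<alpha> \<in> {0..1} \<Longrightarrow> closed (conf_set \<pi> \<alpha>) \<and> convex (conf_set \<pi> \<alpha>)"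
    and conf_interior:
      "\<And>\<alpha>. \<alpha> \<in> {0..<1} \<Longrightarrow> interior (conf_set \<pi> \<alpha>) \<noteq> {}"
    and l_pos: "0 < l"
  shows "\<forall>x\<in>\<X>.
    (SUP P\<in>ambiguity_set \<pi> l \<U>. CVaR \<epsilon> P (\<lambda>a. g (a \<bullet> x))) \<le> ereal b \<longleftrightarrow>
    (\<exists>(w::real) (t::real) (v::nat \<Rightarrow> real).
       w + (\<Sum>i\<in>{0..l}. (real i / real l - 1) * v i) \<le> (b - t) * (1 - \<epsilon>) \<and>
       (\<forall>i\<in>{0..l}. w - (\<Sum>j\<in>{0..i}. v j) \<ge> 0) \<and>
       (\<forall>i\<in>{0..l}. \<forall>a\<in>conf_set \<pi> (real i / real l).
          w - (\<Sum>j\<in>{0..i}. v j) + t \<ge> g (a \<bullet> x)) \<and>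
       (\<forall>i\<in>{0..l}. v i \<ge> 0))"
proof
  fix x :: "real ^ 'n"
  define C where "C i = conf_set \<pi> (real i / real l)" for i
  define X where "X a = g (a \<bullet> x)" for a
  let ?A = "ambiguity_set \<pi> l \<U>"
  let ?B = "restrict_space borel \<U>"
  have range: "0 \<le> \<pi> a" "\<pi> a \<le> 1" for a
    using pi_range by auto
  have C_anti: "C j \<subseteq> C i" if "i \<le> j" for i j
    unfolding C_def using that by (intro conf_set_antimono[OF range]) (auto simp: divide_right_mono)
  have C0: "C 0 = \<U>"
    by (simp add: C_def supp)
  have C_sub: "C i \<subseteq> \<U>" for i
    using C_anti[of 0 i] C0 by simp
  have C_closed: "closed (C i)" if "i \<le> l" for i
    using conf_closed_convex[of "real i / real l"] that l_pos by (simp add: C_def)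
  have C_compact: "compact (C i)" if "i \<le> l" for i
    using C_closed[OF that] C_sub supp(2) by (metis compact_Int_closed inf.absorb2)
  have C_nonempty: "C i \<noteq> {}" if "i \<le> l" for i
  proof -
    obtain h where "\<pi> h = 1"
      using pi_normal by blast
    then have "h \<in> C l"
      using l_pos by (simp add: C_def conf_set_def)
    then show ?thesis
      using C_anti[OF that] by auto
  qed
  have U_sets: "\<U> \<in> sets borel"
    using supp(2) by (auto intro: borel_closed compact_imp_closed)
  have C_sets: "C i \<in> sets ?B" if "i \<le> l" for i
    using C_closed[OF that] C_sub U_sets by (simp add: sets_restrict_space_iff borel_closed)
  have "X \<in> borel_measurable borel"
    unfolding X_def
    by (intro measurable_compose[OF _ borel_measurable_mono[OF g_mono]]) simp
  then have X_meas: "X \<in> borel_measurable ?B"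
    by (rule measurable_restrict_space1)

  show "(SUP P\<in>?A. CVaR \<epsilon> P (\<lambda>a. g (a \<bullet> x))) \<le> ereal b \<longleftrightarrow>
    (\<exists>(w::real) (t::real) (v::nat \<Rightarrow> real).
       w + (\<Sum>i\<in>{0..l}. (real i / real l - 1) * v i) \<le> (b - t) * (1 - \<epsilon>) \<and>
       (\<forall>i\<in>{0..l}. w - (\<Sum>j\<in>{0..i}. v j) \<ge> 0) \<and>
       (\<forall>i\<in>{0..l}. \<forall>a\<in>conf_set \<pi> (real i / real l).
          w - (\<Sum>j\<in>{0..i}. v j) + t \<ge> g (a \<bullet> x)) \<and>
       (\<forall>i\<in>{0..l}. v i \<ge> 0))" (is "?lhs \<longleftrightarrow> ?rhs")
    unfolding C_def[symmetric] X_def[symmetric]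
  proof (intro iffI, goal_cases)
    case 1
    have "\<exists>a\<in>C k. \<forall>c\<in>C k. c \<bullet> x \<le> a \<bullet> x" if "k \<le> l" for k
      using C_compact[OF that] C_nonempty[OF that]
      by (intro continuous_attains_sup continuous_intros)
    then obtain a where a: "\<And>k. k \<le> l \<Longrightarrow> a k \<in> C k"
        "\<And>k c. k \<le> l \<Longrightarrow> c \<in> C k \<Longrightarrow> c \<bullet> x \<le> a k \<bullet> x"
      by metis
    have X_max: "X c \<le> X (a k)" if "k \<le> l" "c \<in> C k" for k c
      unfolding X_def using a(2)[OF that] by (rule monoD[OF g_mono])
    \<comment> \<open>constant beyond \<open>l\<close> so that it maps every index into \<open>\<U>\<close>\<close>
    define a' where "a' k = a (min k l)" for k
    have "a' k \<in> \<U>" for k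
      using a(1)[of "min k l"] C_sub by (auto simp: a'_def)
    then have a'_meas: "a' \<in> measurable (count_space UNIV) ?B"
      by (simp add: space_restrict_space)
    define M where "M = measure_pmf (pmf_of_set {..<l})"
    have M_meas: "a' \<in> measurable M ?B"
      using a'_meas by (simp add: M_def)
    define P where "P = distr M ?B a'"
    have "prob_space P"
      unfolding P_def M_def
      by (intro prob_space.prob_space_distr M_meas[unfolded M_def] prob_space_measure_pmf)
    moreover have "measure P (C i) \<ge> 1 - real i / real l" if "i \<le> l" for i
    proof -
      have ne: "{..<l} \<noteq> {}"
        using l_pos by auto
      \<comment> \<open>By nesting, the maximisers with indices \<open>i, ..., l - 1\<close> all lie
        in \<open>C i\<close>. Counting indices instead of points allows maximisers to
        coincide.\<close>
      have "{i..<l} \<subseteq> {..<l} \<inter> a' -` C i"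
        using a(1) C_anti by (force simp: a'_def min_def)
      then have "card {i..<l} \<le> card ({..<l} \<inter> a' -` C i)"
        by (intro card_mono) auto
      then have "real (l - i) / real l \<le> measure M (a' -` C i)"
        by (simp add: M_def measure_pmf_of_set[OF ne] divide_right_mono)
      also have "\<dots> = measure P (C i)"
        using measure_distr[OF M_meas C_sets[OF that]] by (simp add: P_def M_def)
      finally show ?thesis
        using that l_pos by (simp add: of_nat_diff field_simps)
    qed
    ultimately have "P \<in> ?A"
      by (simp add: ambiguity_set_def prob_distributions_def P_def C_def)
    then have "CVaR \<epsilon> P X \<le> ereal b"
      using 1 by (meson SUP_upper order_trans)
    then have inf: "(INF t. ereal (t + 1 / (1 - \<epsilon>) * ((\<Sum>k<l. max 0 (X (a' k) - t)) / real l))) \<le> ereal b"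
      using CVaR_uniform[OF l_pos a'_meas X_meas, of \<epsilon>] by (simp add: P_def M_def)
    \<comment> \<open>The system asks for a single \<open>t\<close>, so the infimum must be
      attained. The slope condition for this reads \<open>1 / (1 - \<epsilon>) \<ge> 1\<close>,
      which is where \<open>0 \<le> \<epsilon>\<close> enters.\<close>
    have "1 \<le> 1 / ((1 - \<epsilon>) * real l) * real l"
      using eps l_pos by (simp add: field_simps)
    then obtain t where "\<And>s. t + 1 / ((1 - \<epsilon>) * real l) * (\<Sum>k<l. max 0 (X (a' k) - t))
        \<le> s + 1 / ((1 - \<epsilon>) * real l) * (\<Sum>k<l. max 0 (X (a' k) - s))"
      using sum_excess_attains_min[OF l_pos, of "1 / ((1 - \<epsilon>) * real l)" "\<lambda>k. X (a' k)"] by blast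
    then have "ereal (t + 1 / (1 - \<epsilon>) * ((\<Sum>k<l. max 0 (X (a' k) - t)) / real l)) \<le>
        (INF t. ereal (t + 1 / (1 - \<epsilon>) * ((\<Sum>k<l. max 0 (X (a' k) - t)) / real l)))"
      by (intro INF_greatest) simp
    from order_trans[OF this inf]
    have "(\<Sum>k<l. max 0 (X (a' k) - t)) / real l / (1 - \<epsilon>) \<le> b - t"
      by (simp add: mult.commute)
    then have t: "(\<Sum>k<l. max 0 (X (a' k) - t)) / real l \<le> (b - t) * (1 - \<epsilon>)"
      using eps by (subst (asm) pos_divide_le_eq) auto
    \<comment> \<open>The index \<open>l\<close> is not among those sampled by \<open>P\<close>, but
      \<open>y l\<close> is needed for the constraints at level \<open>l\<close>; the first
      constraint gives \<open>v l\<close> weight 0.\<close>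
    define y where "y k = max 0 (X (a k) - t)" for k
    define v where "v k = (if k = 0 then 0 else y (k - 1) - y k)" for k
    have y: "y 0 - (\<Sum>j\<in>{0..i}. v j) = y i" for i
      by (induction i) (auto simp: v_def)
    have "(\<Sum>k<l. max 0 (X (a' k) - t)) = (\<Sum>k<l. y k)"
      by (intro sum.cong) (auto simp: a'_def y_def)
    then have "y 0 + (\<Sum>i\<in>{0..l}. (real i / real l - 1) * v i) \<le> (b - t) * (1 - \<epsilon>)"
      using t by (simp add: sum_by_parts_weights[OF l_pos] y)
    moreover have "X c \<le> y i + t" if "i \<le> l" "c \<in> C i" for i c
      using X_max[OF that] by (simp add: y_def)
    moreover have "0 \<le> y i" for i
      by (simp add: y_def)
    moreover have "0 \<le> v i" if "i \<le> l" for i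
    proof (cases i)
      case (Suc k)
      then have "X (a i) \<le> X (a k)"
        using that a(1)[of i] C_anti[of k i] by (intro X_max) auto
      then show ?thesis
        using Suc by (simp add: v_def y_def)
    qed (simp add: v_def)
    ultimately show ?case
      by (intro exI[of _ "y 0"] exI[of _ t] exI[of _ v]) (auto simp: y)
  next
    case 2
    then obtain w t v where
      bound: "w + (\<Sum>i\<in>{0..l}. (real i / real l - 1) * v i) \<le> (b - t) * (1 - \<epsilon>)"
      and nonneg: "\<And>i. i \<le> l \<Longrightarrow> 0 \<le> w - (\<Sum>j\<in>{0..i}. v j)"
      and above: "\<And>i a. i \<le> l \<Longrightarrow> a \<in> C i \<Longrightarrow> X a \<le> w - (\<Sum>j\<in>{0..i}. v j) + t"
      and v: "\<And>i. i \<le> l \<Longrightarrow> 0 \<le> v i"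
      by auto
    have dom: "max 0 (X a - t) \<le> w - (\<Sum>j\<in>{0..l}. v j * indicator (C j) a)" if "a \<in> \<U>" for a
    proof -
      \<comment> \<open>As the sets \<open>C j\<close> are nested, \<open>a\<close> lies in exactly
        those with \<open>j \<le> i\<close>, so the indicator sum collapses to the partial sum up to
        \<open>i\<close>, and the two constraints at level \<open>i\<close> give the bound.\<close>
      define i where "i = Max {i. i \<le> l \<and> a \<in> C i}"
      have "{i. i \<le> l \<and> a \<in> C i} \<noteq> {}"
        using that C0 by auto
      then have "i \<in> {i. i \<le> l \<and> a \<in> C i}"
        unfolding i_def by (intro Max_in) auto
      then have i: "i \<le> l" "a \<in> C i"
        by auto
      have i_max: "j \<le> i" if "j \<le> l" "a \<in> C j" for j
        using that by (simp add: i_def)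
      have "(\<Sum>j\<in>{0..l}. v j * indicator (C j) a) = (\<Sum>j\<in>{0..i}. v j)"
      proof (rule sum.mono_neutral_cong_right)
        show "\<forall>j\<in>{0..l} - {0..i}. v j * indicator (C j) a = 0"
          using i_max by (force simp: indicator_def)
        show "v j * indicator (C j) a = v j" if "j \<in> {0..i}" for j
          using that i C_anti[of j i] by auto
      qed (use i in auto)
      then show ?thesis
        using nonneg[OF i(1)] above[OF i] by simp
    qed
    show ?case
    proof (rule SUP_least)
      fix P assume "P \<in> ?A"
      then have "prob_space P" and P_sets: "sets P = sets ?B"
        and P: "\<And>i. i \<le> l \<Longrightarrow> 1 - real i / real l \<le> measure P (C i)"
        by (auto simp: ambiguity_set_def prob_distributions_def C_def)
      moreover have "space P = \<U>"
        using sets_eq_imp_space_eq[OF P_sets] by (simp add: space_restrict_space)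
      moreover have "w - (\<Sum>i\<in>{0..l}. v i * (1 - real i / real l)) \<le> (b - t) * (1 - \<epsilon>)"
        using bound by (simp add: algebra_simps sum_subtractf)
      ultimately show "CVaR \<epsilon> P X \<le> ereal b"
        using eps C_sets v dom
        by (intro CVaR_le_of_dominated[where J = "{0..l}" and D = C
              and p = "\<lambda>i. 1 - real i / real l"]) auto
    qed
  qed
qed

end
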